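(* Let $\Sigma$, $\Gamma$, a data stream $\mathbf D$, a time point $t\geq1$ and a stream logic program $\mathcal P$ be as in the context. A stream $\mathbf I$ is a $\Phi_{\mathcal P,\mathbf D,t}$-answer stream if, and only if, there is a total $t$-level mapping of $\mathbf I$ with respect to $\mathcal P$ (for $\mathbf D$).
   Context: $\Sigma$ is a finite nonempty set of propositional atoms containing a special symbol $\top$. Formulas are given by the grammar $\alpha::=a\mid\neg\alpha\mid\alpha\land\alpha\mid\alpha\lor\alpha\mid\alpha\rightarrow\alpha\mid\Diamond\alpha\mid\Box\alpha\mid @_{t'}\alpha\mid\boxplus_{[\ell,r]}\alpha$ with $a\in\Sigma$, integer $t'\geq1$, $\ell,r\in\mathbb N\cup\{\infty\}$, $\ell\leq r$. A formula is normal if it contains none of $\neg,\lor,\rightarrow,\Diamond$. A stream is an infinite sequence $\mathbf I=I_1I_2\ldots$ with $I_s\subseteq\Sigma$; $\mathbf J\subseteq\mathbf I$ means $J_s\subseteq I_s$ for all $s$; unions, intersections, differences are pointwise; $\emptyset$ is the stream with all components empty; $\{a\}_s$ has $\{a\}$ at $s$ and $\emptyset$ elsewhere. $\mathrm{supp}\,\mathbf I$ is the tightest interval of time points containing $\{s\mid I_s\neq\emptyset\}$, $\mathrm{supp}\,\emptyset=\emptyset$. $\mathbf I[\ell,r;s]$ is the stream agreeing with $\mathbf I$ at time points $u$ with $s-\ell\leq u\leq s+r$ and empty elsewhere. Fix $\Gamma\subseteq\Sigma$. Entailment: $\mathbf I,s\models_\Gamma\top$; for $a\neq\top$, $\mathbf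 I,s\models_\Gamma a$ iff $a\in I_s\cup\Gamma$; $\neg,\land,\lor,\rightarrow$ classically; $\Diamond\alpha$ (resp. $\Box\alpha$) holds at $s$ iff $\alpha$ holds at some (resp. every) $s'\in\mathrm{supp}\,\mathbf I$; $\mathbf I,s\models_\Gamma@_{s'}\alpha$ iff $\mathbf I,s'\models_\Gamma\alpha$; $\mathbf I,s\models_\Gamma\boxplus_{[\ell,r]}\alpha$ iff $\mathbf I[\ell,r;s],s\models_\Gamma\alpha$. $\mathbf I$ is then an $s$-model of $\alpha$; $\alpha$ is $s$-consistent if it has an $s$-model. Partial model operator on normal formulas: $\mathrm M_{\mathbf I,s}(a)=\{a\}_s$ if $a\notin\Gamma$, $\emptyset$ if $a\in\Gamma$; $\mathrm M_{\mathbf I,s}(\alpha\land\beta)=\mathrm M_{\mathbf I,s}(\alpha)\cup\mathrm M_{\mathbf I,s}(\beta)$; $\mathrm M_{\mathbf I,s}(\Box\alpha)=\bigcup_{s'\in\mathrm{supp}\,\mathbf I}\mathrm M_{\mathbf I,s'}(\alpha)$; $\mathrm M_{\mathbf I,s}(@_{s'}\alpha)=\mathrm M_{\mathbf I,s'}(\alpha)$; $\mathrm M_{\mathbf I,s}(\boxplus_{[\ell,r]}\alpha)=\mathrm M_{\mathbf I[\ell,r;s],s}(\alpha)$; for a finite set $A$, $\mathrm M_{\mathbf I,s}(A)=\bigcup_{\alpha\in A}\mathrm M_{\mathbf I,s}(\alpha)$. $\mathrm{MM}_{\mathbf I,s}(X)=\mathrm M_{\mathrm M_{\mathbf I,s}(X),s}(X)$.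 A program $\mathcal P$ is a finite nonempty set of rules $\rho$: $\alpha\leftarrow\beta_1,\ldots,\beta_j,{\sim}\beta_{j+1},\ldots,{\sim}\beta_k$ ($k\geq j\geq1$), with $\alpha$ a normal formula, assumed $t$-consistent, and formulas $\beta_i$; $\mathrm H(\rho)=\alpha$, $\mathrm B(\rho)=\beta_1\land\cdots\land\beta_j\land\neg\beta_{j+1}\land\cdots\land\neg\beta_k$. $\mathbf D$ is a fixed data stream. $\mathbf I$ is a $t$-model of $\mathcal P$ (for $\mathbf D$) if $\mathbf D\subseteq\mathbf I$ and $\mathbf I,t\models_\Gamma\mathrm B(\rho)\rightarrow\mathrm H(\rho)$ for all $\rho\in\mathcal P$. 3-valued stream: pair $(\mathbf I,\mathbf J)$ with $\mathbf I\subseteq\mathbf J$; $(\mathbf I,\mathbf J),t\models_\Gamma\alpha$ iff $\mathbf K,t\models_\Gamma\alpha$ for all $\mathbf K$ with $\mathbf I\subseteq\mathbf K\subseteq\mathbf J$. Fitting operator: $\Phi_{\mathcal P,\mathbf D,t}(\mathbf I,\mathbf J)=\mathbf D\cup\mathrm{MM}_{\mathbf I,t}(\{\mathrm H(\rho)\mid\rho\in\mathcal P,\ (\mathbf I,\mathbf J),t\models_\Gamma\mathrm B(\rho)\})$. For a $t$-model $\mathbf I$ of $\mathcal P$, $\Phi^{\uparrow}_{\mathcal P,\mathbf D,t}(\mathbf I)$ is the least fixed point of $\mathbf K\mapsto\Phi_{\mathcal P,\mathbf D,t}(\mathbf K,\mathbf I)$ on $\{\mathbf K\mid\mathbf K\subseteq\mathbf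 I\}$; a $t$-model $\mathbf I$ of $\mathcal P$ is a $\Phi_{\mathcal P,\mathbf D,t}$-answer stream if $\Phi^{\uparrow}_{\mathcal P,\mathbf D,t}(\mathbf I)=\mathbf I$. A partitioning of a stream $\mathbf I$ is a sequence of streams $\mathbf S=(\mathbf S_0,\mathbf S_1,\ldots,\mathbf S_m)$, $m\geq1$, with $\mathbf S_0=\emptyset$, $\mathbf S_1\cup\cdots\cup\mathbf S_m=\mathbf I$, $\mathbf S_i\neq\emptyset$ for $i\geq1$, and $\mathbf S_i\cap\mathbf S_j=\emptyset$ for all distinct $i,j\geq1$. A $t$-level mapping of $\mathbf I$ with respect to $\mathcal P$ (for $\mathbf D$) is a partitioning $\mathbf S$ of $\mathbf I$ such that for all $1\leq i\leq m$, $\mathbf S_i\subseteq\mathbf D\cup\mathrm{MM}_{\mathbf S_1\cup\cdots\cup\mathbf S_{i-1},t}(\{\mathrm H(\rho)\mid\rho\in\mathcal P,\ (\mathbf S_1\cup\cdots\cup\mathbf S_{i-1},\mathbf I),t\models_\Gamma\mathrm B(\rho)\})$. It is total if moreover $\mathbf I$ is a $t$-model of $\mathcal P$.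
   Formalization: Two cases where the equivalence fails as stated are excluded: the stream I is assumed to be nonempty, and the symbol ⊤ is assumed either to belong to Γ or to occur in no rule head of the program. *)

theory Defs
  imports Main "HOL-Library.Extended_Nat"
begin

text \<open>
  The finite nonempty alphabet is a type \<open>'a :: finite\<close>; the special atom is a parameter
  \<open>tp :: 'a\<close>, and the background set \<open>\<Gamma>\<close> is a parameter of type \<open>'a set\<close>.

  Time points are the positive naturals. A stream is a function on \<open>nat\<close> that is empty at the
  dummy index 0; inclusion, unions, intersections, differences and the empty stream are the pointwise
  lattice operations \<open>\<le>\<close>, \<open>sup\<close>/\<open>SUP\<close>, \<open>inf\<close>, \<open>-\<close> and \<open>bot\<close> on functions. Every function below a
  stream is again a stream.
\<close>

type_synonym 'a stream = "nat \<Rightarrow> 'a set"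

definition is_stream :: "'a stream \<Rightarrow> bool" where
  "is_stream I \<longleftrightarrow> I 0 = {}"

definition single :: "'a \<Rightarrow> nat \<Rightarrow> 'a stream" where
  "single a s = (\<lambda>u. if u = s then {a} else {})"

text \<open>Intervals of time points may be unbounded above, so they are the order-convex sets.\<close>

definition supp :: "'a stream \<Rightarrow> nat set" where
  "supp I = \<Inter>{J. (\<forall>u\<in>J. \<forall>v\<in>J. {u..v} \<subseteq> J) \<and> {s. I s \<noteq> {}} \<subseteq> J}"

text \<open>The lower bound \<open>s - l \<le> u\<close> is written \<open>s \<le> u + l\<close> to avoid truncated subtraction.\<close>

definition window :: "'a stream \<Rightarrow> enat \<Rightarrow> enat \<Rightarrow> nat \<Rightarrow> 'a stream" where
  "window I l r s =
    (\<lambda>u. if enat s \<le> enat u + l \<and> enat u \<le> enat s + r then I u else {})"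

datatype (atoms: 'a) formula =
    Atom 'a
  | Neg "'a formula"
  | And "'a formula" "'a formula"
  | Or "'a formula" "'a formula"
  | Imp "'a formula" "'a formula"
  | Dia "'a formula"
  | Box "'a formula"
  | At nat "'a formula"
  | Win enat enat "'a formula"

text \<open>The side conditions of the grammar.\<close>

primrec wf_formula :: "'a formula \<Rightarrow> bool" where
  "wf_formula (Atom a) \<longleftrightarrow> True"
| "wf_formula (Neg \<alpha>) \<longleftrightarrow> wf_formula \<alpha>"
| "wf_formula (And \<alpha> \<beta>) \<longleftrightarrow> wf_formula \<alpha> \<and> wf_formula \<beta>"
| "wf_formula (Or \<alpha> \<beta>) \<longleftrightarrow> wf_formula \<alpha> \<and> wf_formula \<beta>"
| "wf_formula (Imp \<alpha> \<beta>) \<longleftrightarrow> wf_formula \<alpha> \<and> wf_formula \<beta>"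
| "wf_formula (Dia \<alpha>) \<longleftrightarrow> wf_formula \<alpha>"
| "wf_formula (Box \<alpha>) \<longleftrightarrow> wf_formula \<alpha>"
| "wf_formula (At s \<alpha>) \<longleftrightarrow> 1 \<le> s \<and> wf_formula \<alpha>"
| "wf_formula (Win l r \<alpha>) \<longleftrightarrow> l \<le> r \<and> wf_formula \<alpha>"

primrec normal :: "'a formula \<Rightarrow> bool" where
  "normal (Atom a) \<longleftrightarrow> True"
| "normal (Neg \<alpha>) \<longleftrightarrow> False"
| "normal (And \<alpha> \<beta>) \<longleftrightarrow> normal \<alpha> \<and> normal \<beta>"
| "normal (Or \<alpha> \<beta>) \<longleftrightarrow> False"
| "normal (Imp \<alpha> \<beta>) \<longleftrightarrow> False"
| "normal (Dia \<alpha>) \<longleftrightarrow> False"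
| "normal (Box \<alpha>) \<longleftrightarrow> normal \<alpha>"
| "normal (At s \<alpha>) \<longleftrightarrow> normal \<alpha>"
| "normal (Win l r \<alpha>) \<longleftrightarrow> normal \<alpha>"

primrec entails :: "'a \<Rightarrow> 'a set \<Rightarrow> 'a stream \<Rightarrow> nat \<Rightarrow> 'a formula \<Rightarrow> bool" where
  "entails tp \<Gamma> I s (Atom a) \<longleftrightarrow> a = tp \<or> a \<in> I s \<union> \<Gamma>"
| "entails tp \<Gamma> I s (Neg \<alpha>) \<longleftrightarrow> \<not> entails tp \<Gamma> I s \<alpha>"
| "entails tp \<Gamma> I s (And \<alpha> \<beta>) \<longleftrightarrow> entails tp \<Gamma> I s \<alpha> \<and> entails tp \<Gamma> I s \<beta>"
| "entails tp \<Gamma> I s (Or \<alpha> \<beta>) \<longleftrightarrow> entails tp \<Gamma> I s \<alpha> \<or> entails tp \<Gamma> I s \<beta>"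
| "entails tp \<Gamma> I s (Imp \<alpha> \<beta>) \<longleftrightarrow> (entails tp \<Gamma> I s \<alpha> \<longrightarrow> entails tp \<Gamma> I s \<beta>)"
| "entails tp \<Gamma> I s (Dia \<alpha>) \<longleftrightarrow> (\<exists>s'\<in>supp I. entails tp \<Gamma> I s' \<alpha>)"
| "entails tp \<Gamma> I s (Box \<alpha>) \<longleftrightarrow> (\<forall>s'\<in>supp I. entails tp \<Gamma> I s' \<alpha>)"
| "entails tp \<Gamma> I s (At s' \<alpha>) \<longleftrightarrow> entails tp \<Gamma> I s' \<alpha>"
| "entails tp \<Gamma> I s (Win l r \<alpha>) \<longleftrightarrow> entails tp \<Gamma> (window I l r s) s \<alpha>"

definition consistent :: "'a \<Rightarrow> 'a set \<Rightarrow> nat \<Rightarrow> 'a formula \<Rightarrow> bool" where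
  "consistent tp \<Gamma> s \<alpha> \<longleftrightarrow> (\<exists>I. is_stream I \<and> entails tp \<Gamma> I s \<alpha>)"

text \<open>The partial model operator is left unspecified outside normal formulas. Pitfall: it has no special clause
  for \<open>tp\<close>, so for \<open>tp \<notin> \<Gamma>\<close> it yields \<open>single tp s\<close> although \<open>tp\<close> is entailed by every stream.\<close>

primrec (nonexhaustive) M :: "'a set \<Rightarrow> 'a stream \<Rightarrow> nat \<Rightarrow> 'a formula \<Rightarrow> 'a stream" where
  "M \<Gamma> I s (Atom a) = (if a \<in> \<Gamma> then bot else single a s)"
| "M \<Gamma> I s (And \<alpha> \<beta>) = sup (M \<Gamma> I s \<alpha>) (M \<Gamma> I s \<beta>)"
| "M \<Gamma> I s (Box \<alpha>) = (SUP s'\<in>supp I. M \<Gamma> I s' \<alpha>)"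
| "M \<Gamma> I s (At s' \<alpha>) = M \<Gamma> I s' \<alpha>"
| "M \<Gamma> I s (Win l r \<alpha>) = M \<Gamma> (window I l r s) s \<alpha>"

definition M_set :: "'a set \<Rightarrow> 'a stream \<Rightarrow> nat \<Rightarrow> 'a formula set \<Rightarrow> 'a stream" where
  "M_set \<Gamma> I s A = (SUP \<alpha>\<in>A. M \<Gamma> I s \<alpha>)"

definition MM :: "'a set \<Rightarrow> 'a stream \<Rightarrow> nat \<Rightarrow> 'a formula set \<Rightarrow> 'a stream" where
  "MM \<Gamma> I s X = M_set \<Gamma> (M_set \<Gamma> I s X) s X"

text \<open>\<open>Rule \<alpha> [\<beta>\<^sub>1, \<dots>, \<beta>\<^sub>j] [\<beta>\<^sub>j\<^sub>+\<^sub>1, \<dots>, \<beta>\<^sub>k]\<close>: head, positive body, negated body.\<close>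

datatype 'a rule =
  Rule (head: "'a formula") (pos: "'a formula list") (neg: "'a formula list")

text \<open>The conjunction associates to the left; it is only used on nonempty lists.\<close>

definition conj :: "'a formula list \<Rightarrow> 'a formula" where
  "conj \<alpha>s = foldl And (hd \<alpha>s) (tl \<alpha>s)"

definition body :: "'a rule \<Rightarrow> 'a formula" where
  "body \<rho> = conj (pos \<rho> @ map Neg (neg \<rho>))"

definition is_rule :: "'a \<Rightarrow> 'a set \<Rightarrow> nat \<Rightarrow> 'a rule \<Rightarrow> bool" where
  "is_rule tp \<Gamma> t \<rho> \<longleftrightarrow>
     wf_formula (head \<rho>) \<and> normal (head \<rho>) \<and> consistent tp \<Gamma> t (head \<rho>) \<and>
     pos \<rho> \<noteq> [] \<and> (\<forall>\<beta>\<in>set (pos \<rho>) \<union> set (neg \<rho>). wf_formula \<beta>)"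

definition is_program :: "'a \<Rightarrow> 'a set \<Rightarrow> nat \<Rightarrow> 'a rule set \<Rightarrow> bool" where
  "is_program tp \<Gamma> t P \<longleftrightarrow> finite P \<and> P \<noteq> {} \<and> (\<forall>\<rho>\<in>P. is_rule tp \<Gamma> t \<rho>)"

definition is_model ::
  "'a \<Rightarrow> 'a set \<Rightarrow> 'a rule set \<Rightarrow> 'a stream \<Rightarrow> nat \<Rightarrow> 'a stream \<Rightarrow> bool" where
  "is_model tp \<Gamma> P D t I \<longleftrightarrow>
     is_stream I \<and> D \<le> I \<and> (\<forall>\<rho>\<in>P. entails tp \<Gamma> I t (Imp (body \<rho>) (head \<rho>)))"

definition entails3 ::
  "'a \<Rightarrow> 'a set \<Rightarrow> 'a stream \<times> 'a stream \<Rightarrow> nat \<Rightarrow> 'a formula \<Rightarrow> bool" where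
  "entails3 tp \<Gamma> IJ s \<alpha> \<longleftrightarrow> (\<forall>K. fst IJ \<le> K \<and> K \<le> snd IJ \<longrightarrow> entails tp \<Gamma> K s \<alpha>)"

definition Phi ::
  "'a \<Rightarrow> 'a set \<Rightarrow> 'a rule set \<Rightarrow> 'a stream \<Rightarrow> nat \<Rightarrow> 'a stream \<times> 'a stream \<Rightarrow> 'a stream" where
  "Phi tp \<Gamma> P D t IJ =
     sup D (MM \<Gamma> (fst IJ) t {head \<rho> |\<rho>. \<rho> \<in> P \<and> entails3 tp \<Gamma> IJ t (body \<rho>)})"

text \<open>Least with respect to stream inclusion.\<close>

definition Phi_up ::
  "'a \<Rightarrow> 'a set \<Rightarrow> 'a rule set \<Rightarrow> 'a stream \<Rightarrow> nat \<Rightarrow> 'a stream \<Rightarrow> 'a stream" where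
  "Phi_up tp \<Gamma> P D t I = (LEAST K. K \<le> I \<and> Phi tp \<Gamma> P D t (K, I) = K)"

definition answer_stream ::
  "'a \<Rightarrow> 'a set \<Rightarrow> 'a rule set \<Rightarrow> 'a stream \<Rightarrow> nat \<Rightarrow> 'a stream \<Rightarrow> bool" where
  "answer_stream tp \<Gamma> P D t I \<longleftrightarrow> is_model tp \<Gamma> P D t I \<and> Phi_up tp \<Gamma> P D t I = I"

text \<open>A sequence of streams indexed by \<open>0, \<dots>, m\<close> is a function on \<open>nat\<close> together with \<open>m\<close>; its
  values beyond \<open>m\<close> are irrelevant.\<close>

definition partitioning :: "nat \<Rightarrow> (nat \<Rightarrow> 'a stream) \<Rightarrow> 'a stream \<Rightarrow> bool" where
  "partitioning m S I \<longleftrightarrow>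
     1 \<le> m \<and> S 0 = bot \<and> (SUP i\<in>{1..m}. S i) = I \<and> (\<forall>i\<in>{1..m}. S i \<noteq> bot) \<and>
     (\<forall>i\<in>{1..m}. \<forall>j\<in>{1..m}. i \<noteq> j \<longrightarrow> inf (S i) (S j) = bot)"

definition level_mapping ::
  "'a \<Rightarrow> 'a set \<Rightarrow> 'a rule set \<Rightarrow> 'a stream \<Rightarrow> nat \<Rightarrow>
   nat \<Rightarrow> (nat \<Rightarrow> 'a stream) \<Rightarrow> 'a stream \<Rightarrow> bool" where
  "level_mapping tp \<Gamma> P D t m S I \<longleftrightarrow>
     partitioning m S I \<and>
     (\<forall>i\<in>{1..m}. let U = (SUP j\<in>{1..<i}. S j) in
        S i \<le> sup D (MM \<Gamma> U t {head \<rho> |\<rho>. \<rho> \<in> P \<and> entails3 tp \<Gamma> (U, I) t (body \<rho>)}))"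

definition total_level_mapping ::
  "'a \<Rightarrow> 'a set \<Rightarrow> 'a rule set \<Rightarrow> 'a stream \<Rightarrow> nat \<Rightarrow>
   nat \<Rightarrow> (nat \<Rightarrow> 'a stream) \<Rightarrow> 'a stream \<Rightarrow> bool" where
  "total_level_mapping tp \<Gamma> P D t m S I \<longleftrightarrow>
     level_mapping tp \<Gamma> P D t m S I \<and> is_model tp \<Gamma> P D t I"

end

theory Submission
  imports Defs
begin

text \<open>
  For a model \<open>I\<close> the operator \<open>K \<mapsto> \<Phi>(K, I)\<close> is monotone with \<open>\<Phi>(I, I) \<subseteq> I\<close>, so
  \<open>\<Phi>\<up>(I)\<close> is its ordinary least fixed point. The levels of a level mapping lie in it by induction;
  conversely, the differences of consecutive Kleene iterates form a level mapping, provided that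
  finitely many iterations suffice although \<open>D\<close> may be infinite. For this, note that
  \<open>M\<close> reads only the set \<open>N\<close> of nonempty time points of its stream, and that up to finitely many fixed
  times its output occupies the union of the intervals \<open>[p, q]\<close> with \<open>p, q \<in> N\<close> and \<open>(p, q) \<in> G\<close>, where
  \<open>G\<close> is determined by the formula and closed under subintervals. Closedness makes this filling of gaps
  idempotent.
\<close>

section \<open>Nonempty time points and the gaps that formulas fill\<close>

definition active :: "'a stream \<Rightarrow> nat set" where
  "active K = {s. K s \<noteq> {}}"

definition ivl_hull :: "nat set \<Rightarrow> nat set" where
  "ivl_hull N = {u. \<exists>p\<in>N. \<exists>q\<in>N. p \<le> u \<and> u \<le> q}"

definition fill :: "(nat \<times> nat) set \<Rightarrow> nat set \<Rightarrow> nat set" where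
  "fill G N = {u. \<exists>p\<in>N. \<exists>q\<in>N. (p, q) \<in> G \<and> p \<le> u \<and> u \<le> q}"

definition subinterval_closed :: "(nat \<times> nat) set \<Rightarrow> bool" where
  "subinterval_closed G \<longleftrightarrow>
     (\<forall>p q p' q'. (p, q) \<in> G \<longrightarrow> p \<le> p' \<longrightarrow> p' \<le> q' \<longrightarrow> q' \<le> q \<longrightarrow> (p', q') \<in> G)"

text \<open>True if \<open>M\<close> puts an atom at the evaluation time itself, whatever the stream
  is. What \<open>Box\<close> yields depends on the support, and \<open>At\<close> leaves the
  evaluation time.\<close>

primrec (nonexhaustive) bare :: "'a set \<Rightarrow> 'a formula \<Rightarrow> bool" where
  "bare \<Gamma> (Atom a) \<longleftrightarrow> a \<notin> \<Gamma>"
| "bare \<Gamma> (And \<alpha> \<beta>) \<longleftrightarrow> bare \<Gamma> \<alpha> \<or> bare \<Gamma> \<beta>"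
| "bare \<Gamma> (Box \<alpha>) \<longleftrightarrow> False"
| "bare \<Gamma> (At s \<alpha>) \<longleftrightarrow> False"
| "bare \<Gamma> (Win l r \<alpha>) \<longleftrightarrow> bare \<Gamma> \<alpha>"

text \<open>An upper bound only: a time named by \<open>At\<close> may stay empty, for instance if
  the atom there is in \<open>\<Gamma>\<close>.\<close>

primrec (nonexhaustive) at_times :: "'a formula \<Rightarrow> nat set" where
  "at_times (Atom a) = {}"
| "at_times (And \<alpha> \<beta>) = at_times \<alpha> \<union> at_times \<beta>"
| "at_times (Box \<alpha>) = at_times \<alpha>"
| "at_times (At s \<alpha>) = insert s (at_times \<alpha>)"
| "at_times (Win l r \<alpha>) = at_times \<alpha>"

text \<open>The pairs \<open>(p, q)\<close> such that evaluating \<open>\<alpha>\<close> at \<open>s\<close>, on any stream that is nonempty at \<open>p\<close> and \<open>q\<close>,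
  puts atoms on all of \<open>[p, q]\<close> through a \<open>Box\<close>. That a \<open>Box\<close> need only look at times \<open>s'\<close> in \<open>[p, q]\<close>
  is because moving \<open>s'\<close> to the nearest point of \<open>[p, q]\<close> loses no pair.\<close>

primrec (nonexhaustive) spans :: "'a set \<Rightarrow> 'a formula \<Rightarrow> nat \<Rightarrow> (nat \<times> nat) set" where
  "spans \<Gamma> (Atom a) s = {}"
| "spans \<Gamma> (And \<alpha> \<beta>) s = spans \<Gamma> \<alpha> s \<union> spans \<Gamma> \<beta> s"
| "spans \<Gamma> (Box \<alpha>) s = {(p, q). bare \<Gamma> \<alpha> \<or> (\<exists>s'\<in>{p..q}. (p, q) \<in> spans \<Gamma> \<alpha> s')}"
| "spans \<Gamma> (At s' \<alpha>) s = spans \<Gamma> \<alpha> s'"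
| "spans \<Gamma> (Win l r \<alpha>) s =
     {(p, q) \<in> spans \<Gamma> \<alpha> s. enat s \<le> enat p + l \<and> enat q \<le> enat s + r}"

section \<open>Nonempty time points of compound streams, and the support\<close>

lemma active_simps [simp]:
  "active bot = {}"
  "active (single a s) = {s}"
  "active (sup K L) = active K \<union> active L"
  "active (\<lambda>u. K u \<union> L u) = active K \<union> active L"
  "active (window K l r s) = {u \<in> active K. enat s \<le> enat u + l \<and> enat u \<le> enat s + r}"
  by (auto simp: active_def single_def window_def)

lemma active_SUP [simp]: "active (SUP x\<in>A. K x) = (\<Union>x\<in>A. active (K x))"
  by (auto simp: active_def)

lemma active_mono: "K \<le> L \<Longrightarrow> active K \<subseteq> active L"
  unfolding active_def le_fun_def by blast

lemma supp_eq_ivl_hull: "supp K = ivl_hull (active K)"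
proof
  have "w \<in> ivl_hull (active K)"
    if u: "u \<in> ivl_hull (active K)" and v: "v \<in> ivl_hull (active K)" and w: "w \<in> {u..v}" for u v w
  proof -
    obtain p q where "p \<in> active K" "p \<le> u" "q \<in> active K" "v \<le> q"
      using u v unfolding ivl_hull_def by blast
    moreover from this w have "p \<le> w" "w \<le> q" by auto
    ultimately show ?thesis unfolding ivl_hull_def by blast
  qed
  then have "\<forall>u\<in>ivl_hull (active K). \<forall>v\<in>ivl_hull (active K). {u..v} \<subseteq> ivl_hull (active K)"
    by blast
  moreover have "{s. K s \<noteq> {}} \<subseteq> ivl_hull (active K)"
    by (auto simp: ivl_hull_def active_def)
  ultimately show "supp K \<subseteq> ivl_hull (active K)"
    unfolding supp_def by (intro Inter_lower) simp
next
  show "ivl_hull (active K) \<subseteq> supp K"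
  proof
    fix u assume "u \<in> ivl_hull (active K)"
    then obtain p q where pq: "K p \<noteq> {}" "K q \<noteq> {}" "u \<in> {p..q}"
      by (auto simp: ivl_hull_def active_def)
    have "u \<in> J"
      if J: "\<forall>u\<in>J. \<forall>v\<in>J. {u..v} \<subseteq> J" and K: "{s. K s \<noteq> {}} \<subseteq> J" for J
    proof -
      have "p \<in> J" "q \<in> J" using K pq by auto
      with J have "{p..q} \<subseteq> J" by simp
      with pq(3) show ?thesis ..
    qed
    then show "u \<in> supp K" unfolding supp_def by simp
  qed
qed

section \<open>Filling gaps is monotone and idempotent\<close>

lemma ivl_hull_mono: "N \<subseteq> N' \<Longrightarrow> ivl_hull N \<subseteq> ivl_hull N'"
  unfolding ivl_hull_def by blast

lemma fill_mono: "N \<subseteq> N' \<Longrightarrow> fill G N \<subseteq> fill G N'"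
  unfolding fill_def by blast

lemma fill_UN: "fill (\<Union>x\<in>A. G x) N = (\<Union>x\<in>A. fill (G x) N)"
  unfolding fill_def by blast

text \<open>Let \<open>a\<close> and \<open>b\<close> be the points of \<open>N\<close> nearest to
  \<open>u\<close> from below and above. A pair that fills \<open>u\<close> either spans
  \<open>[a, b]\<close> or has an endpoint strictly inside this gap; that endpoint was itself filled
  from \<open>N\<close>, by a pair that must straddle the gap. Closedness then gives
  \<open>(a, b) \<in> G\<close>.\<close>

lemma fill_Un_fill:
  assumes "subinterval_closed G"
  shows "fill G (N \<union> fill G N) = fill G N"
proof
  show "fill G (N \<union> fill G N) \<subseteq> fill G N"
  proof
    fix u assume "u \<in> fill G (N \<union> fill G N)"
    then obtain p q where pq: "p \<in> N \<union> fill G N" "q \<in> N \<union> fill G N" "(p, q) \<in> G" "p \<le> u" "u \<le> q"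
      by (auto simp: fill_def)
    obtain p1 q1 where p1: "p1 \<in> N" "p1 \<le> p" "p \<in> N \<or> (q1 \<in> N \<and> p \<le> q1 \<and> (p1, q1) \<in> G)"
      using pq(1) by (auto simp: fill_def)
    obtain p2 q2 where q2: "q2 \<in> N" "q \<le> q2" "q \<in> N \<or> (p2 \<in> N \<and> p2 \<le> q \<and> (p2, q2) \<in> G)"
      using pq(2) by (auto simp: fill_def)
    define a where "a = (GREATEST x. x \<in> N \<and> x \<le> u)"
    define b where "b = (LEAST x. x \<in> N \<and> u \<le> x)"
    have "p1 \<in> N \<and> p1 \<le> u" "q2 \<in> N \<and> u \<le> q2" using p1 q2 pq by auto
    then have a: "a \<in> N" "a \<le> u" and b: "b \<in> N" "u \<le> b"
      unfolding a_def b_def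
      using GreatestI_nat[of "\<lambda>x. x \<in> N \<and> x \<le> u" p1 u] LeastI[of "\<lambda>x. x \<in> N \<and> u \<le> x" q2] by auto
    have a': "x \<le> a" if "x \<in> N" "x \<le> u" for x
      unfolding a_def using that Greatest_le_nat[of "\<lambda>x. x \<in> N \<and> x \<le> u" x u] by auto
    have b': "b \<le> x" if "x \<in> N" "u \<le> x" for x
      unfolding b_def using that by (auto intro: Least_le)
    have "\<exists>p q. (p, q) \<in> G \<and> p \<le> a \<and> b \<le> q"
    proof (cases "p \<le> a")
      case True
      then show ?thesis
      proof (cases "b \<le> q")
        case True
        with \<open>p \<le> a\<close> pq(3) show ?thesis by blast
      next
        case False
        with b' pq(5) have "q \<notin> N" by blast
        with q2 have "p2 \<in> N" "p2 \<le> q" "(p2, q2) \<in> G" by auto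
        moreover have "p2 \<le> a"
          using a'[of p2] b'[of p2] \<open>p2 \<in> N\<close> \<open>p2 \<le> q\<close> False by linarith
        moreover have "b \<le> q2" using b' q2 pq by auto
        ultimately show ?thesis by blast
      qed
    next
      case False
      with a' pq(4) have "p \<notin> N" by blast
      with p1 have "q1 \<in> N" "p \<le> q1" "(p1, q1) \<in> G" by auto
      moreover have "b \<le> q1"
        using a'[of q1] b'[of q1] \<open>q1 \<in> N\<close> \<open>p \<le> q1\<close> False by linarith
      moreover have "p1 \<le> a" using a' p1 pq by auto
      ultimately show ?thesis by blast
    qed
    then have "(a, b) \<in> G"
      using assms a b unfolding subinterval_closed_def by (blast intro: order_trans)
    with a b show "u \<in> fill G N" by (auto simp: fill_def)
  qed
qed (simp add: fill_mono)

text \<open>Only points \<open>p\<close> with \<open>(p, p) \<in> G\<close> matter for filling, and those survive it.\<close>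

lemma fill_Un_absorb:
  assumes "subinterval_closed G"
  shows "fill G (E \<union> fill G N) = fill G (E \<union> N)"
proof
  have "fill G (E \<union> fill G N) \<subseteq> fill G ((E \<union> N) \<union> fill G (E \<union> N))"
    using fill_mono[of N "E \<union> N" G] by (intro fill_mono) auto
  then show "fill G (E \<union> fill G N) \<subseteq> fill G (E \<union> N)"
    by (simp add: fill_Un_fill[OF assms])
next
  show "fill G (E \<union> N) \<subseteq> fill G (E \<union> fill G N)"
  proof
    fix u assume "u \<in> fill G (E \<union> N)"
    then obtain p q where pq: "p \<in> E \<union> N" "q \<in> E \<union> N" "(p, q) \<in> G" "p \<le> u" "u \<le> q"
      by (auto simp: fill_def)
    moreover from this have "p \<le> q" by simp
    ultimately have "(p, p) \<in> G" "(q, q) \<in> G"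
      using assms unfolding subinterval_closed_def by blast+
    with pq have "p \<in> E \<union> fill G N" "q \<in> E \<union> fill G N" by (auto simp: fill_def)
    show "u \<in> fill G (E \<union> fill G N)"
      using pq \<open>p \<in> E \<union> fill G N\<close> \<open>q \<in> E \<union> fill G N\<close> unfolding fill_def[of G "E \<union> fill G N"] by blast
  qed
qed

section \<open>Where the partial model operator puts atoms\<close>

text \<open>\<open>max p' (min q' s)\<close> is the point of \<open>[p', q']\<close> nearest to
  \<open>s\<close>. The second conjunct lets a \<open>Box\<close> witness move into the shorter
  interval; it passes through windows because the moved time still meets both window bounds.\<close>

lemma spans_clamp:
  assumes "normal \<alpha>" "(p, q) \<in> spans \<Gamma> \<alpha> s" "p \<le> p'" "p' \<le> q'" "q' \<le> q"
  shows "(p', q') \<in> spans \<Gamma> \<alpha> s \<and> (p', q') \<in> spans \<Gamma> \<alpha> (max p' (min q' s))"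
  using assms
proof (induction \<alpha> arbitrary: s)
  case (Box \<alpha>)
  show ?case
  proof (cases "bare \<Gamma> \<alpha>")
    case False
    then obtain s' where "(p, q) \<in> spans \<Gamma> \<alpha> s'" using Box.prems by auto
    then have "(p', q') \<in> spans \<Gamma> \<alpha> (max p' (min q' s'))" using Box by auto
    moreover have "max p' (min q' s') \<in> {p'..q'}" using Box.prems by auto
    ultimately show ?thesis by auto
  qed simp
next
  case (Win l r \<alpha>)
  then have "(p', q') \<in> spans \<Gamma> \<alpha> s \<and> (p', q') \<in> spans \<Gamma> \<alpha> (max p' (min q' s))" by auto
  moreover have "enat s \<le> enat p + l" "enat q \<le> enat s + r" using Win.prems by auto
  ultimately show ?case using Win.prems by (cases l; cases r) auto
qed auto

text \<open>The bounds differ only by the finite set \<open>at_times \<alpha>\<close>. A bare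
  formula under \<open>Box\<close> occupies the whole support, that is, it fills between any two
  nonempty points; \<open>Win\<close> only discards pairs.\<close>

lemma active_M:
  assumes "normal \<alpha>"
  shows "fill (spans \<Gamma> \<alpha> s) (active K) \<union> {u. u = s \<and> bare \<Gamma> \<alpha>} \<subseteq> active (M \<Gamma> K s \<alpha>)"
    and "active (M \<Gamma> K s \<alpha>) \<subseteq>
      fill (spans \<Gamma> \<alpha> s) (active K) \<union> {u. u = s \<and> bare \<Gamma> \<alpha>} \<union> at_times \<alpha>"
  using assms
proof (induction \<alpha> arbitrary: K s)
  case (Atom a)
  { case 1 then show ?case by (auto simp: fill_def)
  next
    case 2 then show ?case by (auto simp: fill_def) }
next
  case (And \<alpha> \<beta>)
  have *: "fill (spans \<Gamma> (And \<alpha> \<beta>) s) N = fill (spans \<Gamma> \<alpha> s) N \<union> fill (spans \<Gamma> \<beta> s) N" for s N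
    unfolding fill_def by auto
  { case 1 then show ?case using And.IH(1,3)[of s K] unfolding * by auto
  next
    case 2 then show ?case using And.IH(2,4)[of K s] unfolding * by auto }
next
  case (Box \<alpha>)
  { case 1
    show ?case
    proof
      fix u assume "u \<in> fill (spans \<Gamma> (Box \<alpha>) s) (active K) \<union> {u. u = s \<and> bare \<Gamma> (Box \<alpha>)}"
      then obtain p q where pq: "p \<in> active K" "q \<in> active K" "p \<le> u" "u \<le> q"
        and "bare \<Gamma> \<alpha> \<or> (\<exists>s'\<in>{p..q}. (p, q) \<in> spans \<Gamma> \<alpha> s')"
        by (auto simp: fill_def)
      \<comment> \<open>For bare \<open>\<alpha>\<close> the witness is \<open>u\<close>
        itself.\<close>
      then obtain s' where s': "s' \<in> {p..q}" "u = s' \<and> bare \<Gamma> \<alpha> \<or> (p, q) \<in> spans \<Gamma> \<alpha> s'" by auto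
      have "s' \<in> supp K" using pq s' by (auto simp: supp_eq_ivl_hull ivl_hull_def)
      moreover have "u \<in> fill (spans \<Gamma> \<alpha> s') (active K) \<union> {u. u = s' \<and> bare \<Gamma> \<alpha>}"
        using pq s' by (auto simp: fill_def)
      then have "u \<in> active (M \<Gamma> K s' \<alpha>)" using Box.IH(1)[of s' K] 1 by auto
      ultimately show "u \<in> active (M \<Gamma> K s (Box \<alpha>))" by auto
    qed
  next
    case 2
    show ?case
    proof
      fix u assume "u \<in> active (M \<Gamma> K s (Box \<alpha>))"
      then obtain s' where s': "s' \<in> supp K" "u \<in> active (M \<Gamma> K s' \<alpha>)" by auto
      with Box.IH(2)[of K s'] 2
      consider "u \<in> fill (spans \<Gamma> \<alpha> s') (active K)" | "u = s'" "bare \<Gamma> \<alpha>" | "u \<in> at_times \<alpha>" by auto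
      then show "u \<in> fill (spans \<Gamma> (Box \<alpha>) s) (active K) \<union> {u. u = s \<and> bare \<Gamma> (Box \<alpha>)} \<union> at_times (Box \<alpha>)"
      proof cases
        case 1
        then obtain p q where pq: "p \<in> active K" "q \<in> active K" "p \<le> u" "u \<le> q" "(p, q) \<in> spans \<Gamma> \<alpha> s'"
          by (auto simp: fill_def)
        \<comment> \<open>\<open>s'\<close> is known only to lie in the support;
          \<open>spans\<close> for \<open>Box\<close> wants it in \<open>[p, q]\<close>.\<close>
        then have "(p, q) \<in> spans \<Gamma> \<alpha> (max p (min q s'))"
          using spans_clamp[of \<alpha> p q \<Gamma> s' p q] 2 by auto
        moreover have "max p (min q s') \<in> {p..q}" using pq by auto
        ultimately have "(p, q) \<in> spans \<Gamma> (Box \<alpha>) s" by auto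
        with pq show ?thesis unfolding fill_def by blast
      next
        case 2
        with s' show ?thesis by (auto simp: supp_eq_ivl_hull ivl_hull_def fill_def)
      qed simp
    qed }
next
  case (At s' \<alpha>)
  { case 1 then show ?case using At.IH(1)[of s' K] by auto
  next
    case 2 then show ?case using At.IH(2)[of K s'] by auto }
next
  case (Win l r \<alpha>)
  have *: "fill (spans \<Gamma> (Win l r \<alpha>) s) (active K) = fill (spans \<Gamma> \<alpha> s) (active (window K l r s))" for s K
  proof -
    \<comment> \<open>\<open>spans\<close> bounds \<open>p\<close> from below and \<open>q\<close>
      from above; since \<open>p \<le> q\<close>, both endpoints meet both bounds and so lie in the
      window.\<close>
    have *: "enat s \<le> enat q + l \<and> enat p \<le> enat s + r"
      if "enat s \<le> enat p + l" "enat q \<le> enat s + r" "p \<le> u" "u \<le> q" for p q u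
      using that by (cases l; cases r; auto)
    show ?thesis
    proof (rule set_eqI, rule iffI)
      fix u assume "u \<in> fill (spans \<Gamma> (Win l r \<alpha>) s) (active K)"
      then obtain p q where "p \<in> active K" "q \<in> active K" "(p, q) \<in> spans \<Gamma> \<alpha> s"
        "enat s \<le> enat p + l" "enat q \<le> enat s + r" "p \<le> u" "u \<le> q"
        unfolding fill_def by auto
      moreover from this have "p \<in> active (window K l r s)" "q \<in> active (window K l r s)"
        using *[of p q u] by simp_all
      ultimately show "u \<in> fill (spans \<Gamma> \<alpha> s) (active (window K l r s))"
        unfolding fill_def by blast
    next
      fix u assume "u \<in> fill (spans \<Gamma> \<alpha> s) (active (window K l r s))"
      then obtain p q where "p \<in> active (window K l r s)" "q \<in> active (window K l r s)"
        "(p, q) \<in> spans \<Gamma> \<alpha> s" "p \<le> u" "u \<le> q"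
        unfolding fill_def by blast
      moreover from this have "p \<in> active K" "q \<in> active K" "(p, q) \<in> spans \<Gamma> (Win l r \<alpha>) s"
        by simp_all
      ultimately show "u \<in> fill (spans \<Gamma> (Win l r \<alpha>) s) (active K)"
        unfolding fill_def by blast
    qed
  qed
  { case 1 then show ?case using Win.IH(1)[of s "window K l r s"] unfolding * by auto
  next
    case 2 then show ?case using Win.IH(2)[of "window K l r s" s] unfolding * by auto }
qed auto

lemma finite_at_times: "normal \<alpha> \<Longrightarrow> finite (at_times \<alpha>)"
  by (induction \<alpha>) auto

section \<open>Monotonicity of the partial model operator and its bound by models\<close>

lemma window_mono: "K \<le> L \<Longrightarrow> window K l r s \<le> window L l r s"
  by (auto simp: window_def le_fun_def)

lemma supp_mono: "K \<le> L \<Longrightarrow> supp K \<subseteq> supp L"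
  by (simp add: supp_eq_ivl_hull active_mono ivl_hull_mono)

text \<open>A larger support only adds terms to the union for \<open>Box\<close>, so
  \<open>M\<close> grows even though entailment of \<open>Box\<close> need not persist.\<close>

lemma M_mono: "normal \<alpha> \<Longrightarrow> K \<le> L \<Longrightarrow> M \<Gamma> K s \<alpha> \<le> M \<Gamma> L s \<alpha>"
proof (induction \<alpha> arbitrary: K L s)
  case (And \<alpha> \<beta>)
  then have "M \<Gamma> K s \<alpha> \<le> M \<Gamma> L s \<alpha>" "M \<Gamma> K s \<beta> \<le> M \<Gamma> L s \<beta>" by simp_all
  then show ?case unfolding M.simps by (rule sup_mono)
next
  case (Box \<alpha>)
  then have "(SUP s'\<in>supp K. M \<Gamma> K s' \<alpha>) \<le> (SUP s'\<in>supp L. M \<Gamma> L s' \<alpha>)"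
    by (intro SUP_subset_mono supp_mono) simp_all
  then show ?case unfolding M.simps .
qed (auto simp: window_mono)

lemma M_cong_active: "normal \<alpha> \<Longrightarrow> active K = active L \<Longrightarrow> M \<Gamma> K s \<alpha> = M \<Gamma> L s \<alpha>"
proof (induction \<alpha> arbitrary: K L s)
  case (And \<alpha> \<beta>)
  have "M \<Gamma> K s \<alpha> = M \<Gamma> L s \<alpha>" "M \<Gamma> K s \<beta> = M \<Gamma> L s \<beta>"
    using And.prems by (auto intro: And.IH)
  then show ?case unfolding M.simps by simp
next
  case (Box \<alpha>)
  have "M \<Gamma> K s' \<alpha> = M \<Gamma> L s' \<alpha>" for s' using Box.prems by (auto intro: Box.IH)
  moreover have "supp K = supp L" using Box.prems(2) by (simp add: supp_eq_ivl_hull)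
  ultimately show ?case unfolding M.simps by simp
next
  case (At s' \<alpha>)
  show ?case using At.prems by (auto intro: At.IH)
next
  case (Win l r \<alpha>)
  show ?case using Win.prems by (auto intro: Win.IH)
qed auto

text \<open>An entailed atom outside \<open>\<Gamma>\<close> lies in the stream unless it is
  \<open>tp\<close>, which is entailed everywhere; the last assumption excludes that case.\<close>

lemma M_le_model:
  assumes "normal \<alpha>" "entails tp \<Gamma> K s \<alpha>" "tp \<in> \<Gamma> \<or> tp \<notin> atoms \<alpha>"
  shows "M \<Gamma> K s \<alpha> \<le> K"
  using assms
proof (induction \<alpha> arbitrary: K s)
  case (Atom a)
  then show ?case by (auto simp: single_def le_fun_def)
next
  case (And \<alpha> \<beta>)
  then have "M \<Gamma> K s \<alpha> \<le> K" "M \<Gamma> K s \<beta> \<le> K" by auto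
  then show ?case unfolding M.simps by (rule sup_least)
next
  case (Box \<alpha>)
  have "M \<Gamma> K s' \<alpha> \<le> K" if "s' \<in> supp K" for s'
    using that Box.prems by (intro Box.IH) auto
  then have "(SUP s'\<in>supp K. M \<Gamma> K s' \<alpha>) \<le> K" by (rule SUP_least)
  then show ?case unfolding M.simps .
next
  case (Win l r \<alpha>)
  then have "M \<Gamma> (window K l r s) s \<alpha> \<le> window K l r s" by auto
  also have "\<dots> \<le> K" by (auto simp: window_def le_fun_def)
  finally show ?case by simp
qed auto

lemma M_set_mono:
  "K \<le> L \<Longrightarrow> X \<subseteq> Y \<Longrightarrow> \<forall>\<alpha>\<in>Y. normal \<alpha> \<Longrightarrow> M_set \<Gamma> K s X \<le> M_set \<Gamma> L s Y"
  unfolding M_set_def by (intro SUP_subset_mono M_mono) auto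

lemma MM_mono:
  "K \<le> L \<Longrightarrow> X \<subseteq> Y \<Longrightarrow> \<forall>\<alpha>\<in>Y. normal \<alpha> \<Longrightarrow> MM \<Gamma> K s X \<le> MM \<Gamma> L s Y"
  unfolding MM_def by (intro M_set_mono) auto

lemma M_set_cong_active:
  "active K = active L \<Longrightarrow> \<forall>\<alpha>\<in>X. normal \<alpha> \<Longrightarrow> M_set \<Gamma> K s X = M_set \<Gamma> L s X"
  unfolding M_set_def by (intro SUP_cong M_cong_active) auto

text \<open>\<open>C\<close> contains the evaluation time and all times named by \<open>At\<close>,
  so outside \<open>C\<close> both bounds of \<open>active_M\<close> reduce to filling.\<close>

lemma active_M_set:
  assumes "\<forall>\<alpha>\<in>X. normal \<alpha>" "insert s (\<Union>\<alpha>\<in>X. at_times \<alpha>) \<subseteq> C"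
  shows "active (M_set \<Gamma> K s X) =
    active (M_set \<Gamma> K s X) \<inter> C \<union> fill (\<Union>\<alpha>\<in>X. spans \<Gamma> \<alpha> s) (active K)"
proof -
  have "fill (spans \<Gamma> \<alpha> s) (active K) \<subseteq> active (M \<Gamma> K s \<alpha>)"
    and "active (M \<Gamma> K s \<alpha>) \<subseteq> fill (spans \<Gamma> \<alpha> s) (active K) \<union> C" if "\<alpha> \<in> X" for \<alpha>
  proof -
    have "normal \<alpha>" "at_times \<alpha> \<subseteq> C" "s \<in> C" using assms that by auto
    then show "fill (spans \<Gamma> \<alpha> s) (active K) \<subseteq> active (M \<Gamma> K s \<alpha>)"
      and "active (M \<Gamma> K s \<alpha>) \<subseteq> fill (spans \<Gamma> \<alpha> s) (active K) \<union> C"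
      using active_M(1)[of \<alpha> \<Gamma> s K] active_M(2)[of \<alpha> \<Gamma> K s] by blast+
  qed
  then show ?thesis
    unfolding M_set_def fill_UN active_SUP by blast
qed

lemma subinterval_closed_spans:
  "\<forall>\<alpha>\<in>X. normal \<alpha> \<Longrightarrow> subinterval_closed (\<Union>\<alpha>\<in>X. spans \<Gamma> \<alpha> s)"
  unfolding subinterval_closed_def using spans_clamp by fast

section \<open>The Fitting operator for a fixed upper bound \<open>I\<close>\<close>

abbreviation fired ::
  "'a \<Rightarrow> 'a set \<Rightarrow> 'a rule set \<Rightarrow> nat \<Rightarrow> 'a stream \<Rightarrow> 'a stream \<Rightarrow> 'a formula set" where
  "fired tp \<Gamma> P t I K \<equiv> {head \<rho> |\<rho>. \<rho> \<in> P \<and> entails3 tp \<Gamma> (K, I) t (body \<rho>)}"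

text \<open>Raising the lower bound shrinks the interval of streams over which
  \<open>entails3\<close> quantifies.\<close>

lemma fired_mono:
  assumes "K \<le> L"
  shows "fired tp \<Gamma> P t I K \<subseteq> fired tp \<Gamma> P t I L"
proof -
  have "entails3 tp \<Gamma> (L, I) t \<alpha>" if "entails3 tp \<Gamma> (K, I) t \<alpha>" for \<alpha>
    using that order_trans[OF assms] by (simp add: entails3_def)
  then show ?thesis by blast
qed

lemma Phi_mono:
  assumes "\<forall>\<rho>\<in>P. normal (head \<rho>)" "K \<le> L"
  shows "Phi tp \<Gamma> P D t (K, I) \<le> Phi tp \<Gamma> P D t (L, I)"
  unfolding Phi_def fst_conv
  using assms by (intro sup_mono order_refl MM_mono fired_mono) auto

text \<open>\<open>entails3\<close> on \<open>(I, I)\<close> gives entailment in \<open>I\<close>,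
  so every fired head holds in the model \<open>I\<close> and \<open>M\<close> stays inside
  \<open>I\<close>. The second application of \<open>M\<close> in \<open>MM\<close> starts from this
  smaller stream and is bounded by the first.\<close>

lemma Phi_model_le:
  assumes "\<forall>\<rho>\<in>P. normal (head \<rho>)" "tp \<in> \<Gamma> \<or> (\<forall>\<rho>\<in>P. tp \<notin> atoms (head \<rho>))"
    and "is_model tp \<Gamma> P D t I"
  shows "Phi tp \<Gamma> P D t (I, I) \<le> I"
proof -
  let ?X = "fired tp \<Gamma> P t I I"
  have "M \<Gamma> I t \<alpha> \<le> I" if \<alpha>: "\<alpha> \<in> ?X" for \<alpha>
  proof -
    obtain \<rho> where \<rho>: "\<rho> \<in> P" "\<alpha> = head \<rho>" "entails3 tp \<Gamma> (I, I) t (body \<rho>)"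
      using \<alpha> by blast
    then have "entails tp \<Gamma> I t \<alpha>"
      using assms(3) by (simp add: is_model_def entails3_def)
    with \<rho> assms(1,2) show ?thesis by (intro M_le_model) auto
  qed
  then have M_set: "M_set \<Gamma> I t ?X \<le> I" unfolding M_set_def by (rule SUP_least)
  then have "MM \<Gamma> I t ?X \<le> M_set \<Gamma> I t ?X"
    unfolding MM_def using assms(1) by (intro M_set_mono) auto
  then have "MM \<Gamma> I t ?X \<le> I" using M_set by (rule order_trans)
  moreover have "D \<le> I" using assms(3) by (simp add: is_model_def)
  ultimately show ?thesis unfolding Phi_def fst_conv by (intro sup_least)
qed

text \<open>A model is a prefixed point by \<open>Phi_model_le\<close>, so the least fixed point
  meets the constraint \<open>K \<le> I\<close> in \<open>Phi_up\<close>.\<close>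

lemma Phi_up_eq_lfp:
  assumes "\<forall>\<rho>\<in>P. normal (head \<rho>)" "tp \<in> \<Gamma> \<or> (\<forall>\<rho>\<in>P. tp \<notin> atoms (head \<rho>))"
    and "is_model tp \<Gamma> P D t I"
  shows "Phi_up tp \<Gamma> P D t I = lfp (\<lambda>K. Phi tp \<Gamma> P D t (K, I))"
proof -
  have "mono (\<lambda>K. Phi tp \<Gamma> P D t (K, I))" using Phi_mono[OF assms(1)] by (rule monoI)
  from lfp_fixpoint[OF this] Phi_model_le[OF assms] show ?thesis
    unfolding Phi_up_def by (intro Least_equality) (auto intro: lfp_lowerbound)
qed

section \<open>Finitely many iterations suffice\<close>

lemma mono_bounded_set_seq_stabilizes:
  fixes f :: "nat \<Rightarrow> 'b set"
  assumes "mono f" "\<And>n. f n \<subseteq> A" "finite A"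
  shows "\<exists>n0. \<forall>n\<ge>n0. f n = f n0"
proof -
  have "finite (\<Union>n. f n)" using assms(2,3) by (meson UN_least finite_subset)
  have "\<forall>x\<in>(\<Union>n. f n). \<exists>n. x \<in> f n" by blast
  \<comment> \<open>\<open>g\<close> picks for each of the finitely many elements a stage at which
    it is present; \<open>n0\<close> bounds these stages, with 0 inserted for the empty
    union.\<close>
  from bchoice[OF this] obtain g where g: "\<forall>x\<in>(\<Union>n. f n). x \<in> f (g x)" ..
  define n0 where "n0 = Max (insert 0 (g ` (\<Union>n. f n)))"
  have "f n = f n0" if "n \<ge> n0" for n
  proof
    show "f n0 \<subseteq> f n" using that by (rule monoD[OF \<open>mono f\<close>])
    show "f n \<subseteq> f n0"
    proof
      fix x assume "x \<in> f n"
      then have "x \<in> (\<Union>n. f n)" by blast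
      with \<open>finite (\<Union>n. f n)\<close> have "g x \<le> n0" unfolding n0_def by (intro Max_ge) auto
      with \<open>x \<in> (\<Union>n. f n)\<close> g monoD[OF \<open>mono f\<close>] show "x \<in> f n0" by blast
    qed
  qed
  then show ?thesis by blast
qed

text \<open>Once the fired rules and the
  traces on the finitely many times named in the heads are constant, the set of nonempty time points
  evolves by a fixed idempotent filling and is constant two steps later.\<close>

lemma Phi_iteration_stabilizes:
  assumes fin: "finite P" and normal: "\<forall>\<rho>\<in>P. normal (head \<rho>)"
  shows "\<exists>n. ((\<lambda>K. Phi tp \<Gamma> P D t (K, I)) ^^ Suc n) bot = ((\<lambda>K. Phi tp \<Gamma> P D t (K, I)) ^^ n) bot"
proof -
  define F where "F = (\<lambda>K. Phi tp \<Gamma> P D t (K, I))"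
  define K where "K n = (F ^^ n) bot" for n
  define X where "X n = fired tp \<Gamma> P t I (K n)" for n
  define L where "L n = M_set \<Gamma> (K n) t (X n)" for n
  define L' where "L' n = M_set \<Gamma> (L n) t (X n)" for n
  define C where "C = insert t (\<Union>\<alpha>\<in>head ` P. at_times \<alpha>)"
  have "finite C" using fin normal by (auto simp: C_def intro: finite_at_times)
  have K_Suc: "K (Suc n) = sup D (L' n)" for n
    by (simp add: K_def F_def Phi_def MM_def L'_def L_def X_def)
  have normal_X: "\<forall>\<alpha>\<in>X n. normal \<alpha>" and X_C: "insert t (\<Union>\<alpha>\<in>X n. at_times \<alpha>) \<subseteq> C"
    and X_sub: "X n \<subseteq> head ` P" for n
    using normal by (auto simp: X_def C_def)
  have "mono F" unfolding F_def using Phi_mono[OF normal] by (rule monoI)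
  then have "mono K" unfolding K_def by (intro monoI) (rule funpow_decreasing)
  then have "mono X" unfolding X_def by (intro monoI fired_mono) (auto dest: monoD)
  have "mono L"
    unfolding L_def using \<open>mono K\<close> \<open>mono X\<close> normal_X by (intro monoI M_set_mono) (auto dest: monoD)
  have "mono L'"
    unfolding L'_def using \<open>mono L\<close> \<open>mono X\<close> normal_X by (intro monoI M_set_mono) (auto dest: monoD)
  have mono_trace: "mono (\<lambda>n. active (V n) \<inter> C)" if "mono V" for V :: "nat \<Rightarrow> 'a stream"
    by (intro monoI Int_mono active_mono monoD[OF that] order_refl)
  obtain n1 where n1: "\<forall>n\<ge>n1. X n = X n1"
    using mono_bounded_set_seq_stabilizes[OF \<open>mono X\<close> X_sub] fin by blast
  obtain n2 where n2: "\<forall>n\<ge>n2. active (L n) \<inter> C = active (L n2) \<inter> C"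
    using mono_bounded_set_seq_stabilizes[OF mono_trace[OF \<open>mono L\<close>] Int_lower2 \<open>finite C\<close>] by blast
  obtain n3 where n3: "\<forall>n\<ge>n3. active (L' n) \<inter> C = active (L' n3) \<inter> C"
    using mono_bounded_set_seq_stabilizes[OF mono_trace[OF \<open>mono L'\<close>] Int_lower2 \<open>finite C\<close>] by blast
  define n0 where "n0 = n1 + n2 + n3"
  define G where "G = (\<Union>\<alpha>\<in>X n1. spans \<Gamma> \<alpha> t)"
  \<comment> \<open>From stage \<open>n0\<close> on, \<open>E\<close> is the constant trace on
    \<open>C\<close> of the inner partial model; \<open>A\<close> joins \<open>D\<close> with the
    constant trace of the outer one.\<close>
  define E where "E = active (L n2) \<inter> C"
  define A where "A = active D \<union> active (L' n3) \<inter> C"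
  have G: "subinterval_closed G" unfolding G_def by (rule subinterval_closed_spans[OF normal_X])
  have step: "active (K (Suc n)) = A \<union> fill G (E \<union> active (K n))" if "n \<ge> n0" for n
  proof -
    have const: "X n = X n1" "active (L n) \<inter> C = E" "active (L' n) \<inter> C = active (L' n3) \<inter> C"
      using that n1[rule_format, of n] n2[rule_format, of n] n3[rule_format, of n]
      by (simp_all add: n0_def E_def)
    have "active (L n) = E \<union> fill G (active (K n))"
      using active_M_set[OF normal_X[of n] X_C, of \<Gamma> "K n"]
      unfolding L_def[symmetric] unfolding const G_def[symmetric] .
    moreover have "active (L' n) = active (L' n3) \<inter> C \<union> fill G (active (L n))"
      using active_M_set[OF normal_X[of n] X_C, of \<Gamma> "L n"]
      unfolding L'_def[symmetric] unfolding const G_def[symmetric] .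
    \<comment> \<open>Each of the two applications of \<open>M\<close> in \<open>MM\<close> fills
      once; \<open>fill_Un_absorb\<close> merges the two fillings.\<close>
    ultimately have "active (K (Suc n)) = A \<union> fill G (E \<union> fill G (active (K n)))"
      unfolding K_Suc A_def by (simp add: Un_assoc)
    then show ?thesis by (simp add: fill_Un_absorb[OF G])
  qed
  let ?n = "Suc (Suc n0)"
  define Y where "Y = E \<union> active (K (Suc n0))"
  have Y: "active (K ?n) = A \<union> fill G Y" using step[of "Suc n0"] by (simp add: Y_def)
  \<comment> \<open>Stage \<open>Suc n0\<close> already contains \<open>A\<close>, so the next
    filling starts from a set including it and idempotence applies.\<close>
  have "A \<subseteq> Y" using step[of n0] by (auto simp: Y_def)
  have "active (K (Suc ?n)) = A \<union> fill G (E \<union> (A \<union> fill G Y))" using step[of ?n] by (simp add: Y)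
  also have "\<dots> \<subseteq> A \<union> fill G (Y \<union> fill G Y)"
    using \<open>A \<subseteq> Y\<close> by (intro Un_mono[OF order_refl] fill_mono) (auto simp: Y_def)
  also have "\<dots> = active (K ?n)" by (simp add: Y fill_Un_fill[OF G])
  finally have "active (K (Suc ?n)) \<subseteq> active (K ?n)" .
  moreover have "active (K ?n) \<subseteq> active (K (Suc ?n))"
    by (intro active_mono monoD[OF \<open>mono K\<close>]) simp
  ultimately have active_eq: "active (K (Suc ?n)) = active (K ?n)" by (rule equalityI)
  have X_eq: "X (Suc ?n) = X ?n"
    using n1[rule_format, of ?n] n1[rule_format, of "Suc ?n"] by (simp add: n0_def)
  \<comment> \<open>Equal nonempty points do not make the streams equal. As \<open>M\<close> reads
    only these points, one more application of the operator does, so the final witness is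
    \<open>Suc ?n\<close>.\<close>
  have "L (Suc ?n) = L ?n"
    unfolding L_def X_eq using active_eq normal_X by (rule M_set_cong_active)
  with X_eq have "L' (Suc ?n) = L' ?n" by (simp only: L'_def)
  then have "K (Suc (Suc ?n)) = K (Suc ?n)" by (simp only: K_Suc)
  then show ?thesis unfolding K_def F_def by blast
qed

section \<open>Level mappings from Kleene iterates, and back\<close>

text \<open>\<open>I \<noteq> bot\<close> is assumed because a partitioning has at least one block
  and no empty block, so \<open>bot\<close> has none. The last assumption keeps \<open>M\<close>
  inside models, as in \<open>M_le_model\<close>.\<close>

theorem theorem4:
  fixes tp :: "'a :: finite" and \<Gamma> :: "'a set" and P :: "'a rule set"
    and D I :: "'a stream" and t :: nat
  assumes "1 \<le> t"
    and "is_stream D"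
    and "is_program tp \<Gamma> t P"
    and "is_stream I"
    and "I \<noteq> bot"
    and "tp \<in> \<Gamma> \<or> (\<forall>\<rho>\<in>P. tp \<notin> atoms (head \<rho>))"
  shows "answer_stream tp \<Gamma> P D t I \<longleftrightarrow> (\<exists>m S. total_level_mapping tp \<Gamma> P D t m S I)"
proof (cases "is_model tp \<Gamma> P D t I")
  case False
  then show ?thesis by (simp add: answer_stream_def total_level_mapping_def)
next
  case model: True
  have normal: "\<forall>\<rho>\<in>P. normal (head \<rho>)" and fin: "finite P"
    using assms(3) by (auto simp: is_program_def is_rule_def)
  define F where "F K = Phi tp \<Gamma> P D t (K, I)" for K
  have "mono F" unfolding F_def using Phi_mono[OF normal] by (rule monoI)
  have Phi_up: "Phi_up tp \<Gamma> P D t I = lfp F"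
    using Phi_up_eq_lfp[OF normal assms(6) model] by (simp add: F_def[abs_def])
  have lfp_le: "lfp F \<le> I"
    using Phi_model_le[OF normal assms(6) model] by (intro lfp_lowerbound) (simp add: F_def)
  have level: "level_mapping tp \<Gamma> P D t m S I \<longleftrightarrow>
      partitioning m S I \<and> (\<forall>i\<in>{1..m}. S i \<le> F (SUP j\<in>{1..<i}. S j))" for m S
    by (simp only: level_mapping_def Let_def F_def Phi_def fst_conv)
  show ?thesis
  proof
    assume "answer_stream tp \<Gamma> P D t I"
    then have I: "lfp F = I" by (simp add: answer_stream_def Phi_up)
    define K where "K n = (F ^^ n) bot" for n
    have "mono K"
      unfolding K_def using \<open>mono F\<close> by (intro monoI) (rule funpow_decreasing)
    obtain n where "K (Suc n) = K n"
      using Phi_iteration_stabilizes[OF fin normal, of tp \<Gamma> D t I] by (auto simp: K_def F_def[abs_def])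
    then have "K n = I"
      using lfp_Kleene_iter[OF \<open>mono F\<close>, of n] I by (simp add: K_def)
    \<comment> \<open>Stopping at the least stage that reaches \<open>I\<close> keeps every level
      nonempty.\<close>
    define m where "m = (LEAST n. K n = I)"
    have K_m: "K m = I" unfolding m_def using \<open>K n = I\<close> by (rule LeastI)
    have K_neq: "K i \<noteq> I" if "i < m" for i using that unfolding m_def by (rule not_less_Least)
    have "1 \<le> m" using K_m assms(5) by (cases m) (auto simp: K_def)
    define S where "S i = (if i = 0 then bot else K i - K (i - 1))" for i
    have S_Suc: "S (Suc i) u = K (Suc i) u - K i u" for i u by (simp add: S_def)
    have sup_S: "(SUP j\<in>{1..i}. S j) = K i" for i
    proof (induction i)
      case 0
      then show ?case by (simp add: K_def)
    next
      case (Suc i)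
      have "(SUP j\<in>{1..Suc i}. S j) = sup (S (Suc i)) (SUP j\<in>{1..i}. S j)"
        by (simp add: atLeastAtMostSuc_conv)
      also have "\<dots> = K (Suc i)"
        unfolding Suc using monoD[OF \<open>mono K\<close>, of i "Suc i"] by (auto simp: fun_eq_iff le_fun_def S_Suc)
      finally show ?case .
    qed
    have "S i \<noteq> bot" if "i \<in> {1..m}" for i
    proof
      assume "S i = bot"
      obtain j where j: "i = Suc j" "j < m" using \<open>i \<in> {1..m}\<close> by (cases i) auto
      have "K (Suc j) \<le> K j" using \<open>S i = bot\<close> j S_Suc[of j] by (auto simp: le_fun_def)
      \<comment> \<open>An empty level makes \<open>K j\<close> a fixed point; it contains
        \<open>lfp F = I\<close> and so would reach \<open>I\<close> before stage
        \<open>m\<close>.\<close>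
      then have "F (K j) = K j" using monoD[OF \<open>mono K\<close>, of j "Suc j"] by (simp add: K_def)
      then have "lfp F \<le> K j" by (simp add: lfp_lowerbound)
      moreover have "K j \<le> K m" using j by (auto intro: monoD[OF \<open>mono K\<close>])
      ultimately show False using K_neq[OF \<open>j < m\<close>] I K_m by auto
    qed
    moreover have disj: "inf (S i) (S j) = bot" if "1 \<le> i" "i < j" for i j
    proof -
      \<comment> \<open>The later level \<open>S j\<close> omits \<open>K (j - 1)\<close>, which
        contains all of \<open>S i\<close>.\<close>
      have "S i \<le> K i" using that by (auto simp: S_def le_fun_def)
      also have "\<dots> \<le> K (j - 1)" using that by (intro monoD[OF \<open>mono K\<close>]) auto
      finally show ?thesis using that by (auto simp: S_def le_fun_def fun_eq_iff)
    qed
    have "inf (S i) (S j) = bot" if "i \<in> {1..m}" "j \<in> {1..m}" "i \<noteq> j" for i j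
      using that disj[of i j] disj[of j i] by (cases "i < j") (auto simp: inf_commute)
    ultimately have "partitioning m S I"
      using \<open>1 \<le> m\<close> K_m sup_S[of m] by (simp add: partitioning_def S_def)
    moreover have "S i \<le> F (SUP j\<in>{1..<i}. S j)" if i: "i \<in> {1..m}" for i
    proof -
      obtain j where j: "i = Suc j" using i by (cases i) auto
      have "(SUP j\<in>{1..<i}. S j) = K j"
        unfolding j atLeastLessThanSuc_atLeastAtMost by (rule sup_S)
      then show ?thesis by (auto simp: j K_def le_fun_def S_def)
    qed
    ultimately have "total_level_mapping tp \<Gamma> P D t m S I"
      unfolding total_level_mapping_def level using model by blast
    then show "\<exists>m S. total_level_mapping tp \<Gamma> P D t m S I" by blast
  next
    assume "\<exists>m S. total_level_mapping tp \<Gamma> P D t m S I"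
    then obtain m S where "partitioning m S I"
      and S: "\<And>i. i \<in> {1..m} \<Longrightarrow> S i \<le> F (SUP j\<in>{1..<i}. S j)"
      by (auto simp: total_level_mapping_def level)
    have "S i \<le> lfp F" if "i \<in> {1..m}" for i
      using that
    proof (induction i rule: less_induct)
      case (less i)
      have "(SUP j\<in>{1..<i}. S j) \<le> lfp F" using less by (intro SUP_least) auto
      then have "F (SUP j\<in>{1..<i}. S j) \<le> F (lfp F)" by (rule monoD[OF \<open>mono F\<close>])
      with S[OF less.prems] show ?case
        by (simp only: lfp_fixpoint[OF \<open>mono F\<close>])
    qed
    then have "(SUP i\<in>{1..m}. S i) \<le> lfp F" by (rule SUP_least)
    then have "I \<le> lfp F" using \<open>partitioning m S I\<close> by (simp only: partitioning_def)
    with lfp_le model show "answer_stream tp \<Gamma> P D t I"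
      by (simp add: answer_stream_def Phi_up antisym)
  qed
qed

end
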